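(* Let $N\ge1$. For any nonzero matrix $M\in\mathrm{Mat}_{N+1}(k)$, there is a canonical ordering on the set $\mathrm{Vert}_+(M)$ of vertices of the corner polyhedron $\Pi_+(M)$, as follows. - If $M$ is upper triangular but not strictly upper triangular, then $\mathrm{Vert}_+(M)=\{0\}$, so the ordering is the trivial one. - For any other nonzero $M$, the map $(i,j)\mapsto\overline{\mathrm{wt}}(a_{ij})=e_i-e_j$ is a bijection from the set of off-diagonal pivotal entries of $M$ (pivotal entries $(i,j)$ with $i\neq j$) to $\mathrm{Vert}_+(M)$. The canonical ordering on $\mathrm{Vert}_+(M)$ can be defined in any of the following equivalent ways: (i) take the ordering inherited from the natural ordering on the pivotal entries; (ii) order by the index of the first nonzero coordinate; (iii) order by the index of the last nonzero coordinate. Here coordinates of a vector $w$ are $(s_1(w),\ldots,s_N(w))$.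
   Context: $k$ is an algebraically closed field. Let $\bar W\subset\mathbb{R}^{N+1}$ be the hyperplane of vectors whose coordinates sum to $0$, with standard basis vectors $e_1,\ldots,e_{N+1}$ of $\mathbb{R}^{N+1}$. For $1\le j\le N$ let $s_j(x)=x_1+\cdots+x_j$. The functionals $s_1,\ldots,s_N$ are a basis of the dual of $\bar W$ and are used as coordinates, identifying $\bar W\cong\mathbb{R}^N$. Let $O^+=\{w\in\bar W: s_j(w)\ge0\ \forall j\}$. For the matrix entry coordinate $a_{ij}$, $\overline{\mathrm{wt}}(a_{ij})=e_i-e_j\in\bar W$. The corner polyhedron of a nonzero $M=(M_{ij})$ is $$\Pi_+(M)=\mathrm{Conv}\{e_i-e_j: M_{ij}\ne0\}+O^+\subset\bar W$$ (Minkowski sum), and $\mathrm{Vert}_+(M)$ is its set of vertices. Profiles. A path in an $(N+1)\times(N+1)$ matrix is a word in letters $\downarrow,\rightarrow$ with $N+1$ instances of each, identified with the lattice path of down- and right-directed unit segments in the gridlines between (and around) entries, from the top-left corner to the bottom-right corner of the matrix. A Dyck path is a path that does not cross the main diagonal (it may meet it). A lower Dyck path is a Dyck path beginning with $\downarrow$ (so it lies weakly below the main diagonal of the grid); an upper Dyck path is one beginning with $\rightarrow$ (lying weakly above it). A path contains $(i,j)$ if the entry $(i,j)$ lies above (i.e. to the upper right of) the path. The profile $\mathrm{Prof}(M)$ is: if $M$ is not strictly upper triangular, the lower Dyck path containing the fewest entries among all lower Dyck paths that contain all nonzero entries of $M$; if $M$ is strictly upper triangular, the upper Dyck path containing the fewest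 entries among all upper Dyck paths that contain all nonzero entries of $M$. A pivotal entry of $M$ is a pair $(i,j)$ such that $\mathrm{Prof}(M)$ follows the closest gridlines to the left of $(i,j)$ and below $(i,j)$; i.e. pivotal entries correspond to occurrences of the subword $\downarrow\rightarrow$ in $\mathrm{Prof}(M)$. The natural ordering on pivotal entries is the order in which they appear along the path from upper-left to bottom-right. *)

theory Defs
  imports
    "HOL-Analysis.Analysis"
    "HOL-Analysis.Finite_Function_Topology"
    "HOL-Computational_Algebra.Polynomial"
    "Jordan_Normal_Form.Matrix"
begin

text \<open>
  Rows and columns of a matrix, and the coordinates of \<open>\<real>\<^sup>N\<^sup>+\<^sup>1\<close>, are numbered
  \<open>0, \<dots>, N\<close>, following the convention of \<^typ>\<open>'a mat\<close>; the functionals \<open>s\<^sub>1, \<dots>, s\<^sub>N\<close>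
  keep the indices \<open>1, \<dots>, N\<close>.  The space \<open>\<real>\<^sup>N\<^sup>+\<^sup>1\<close> is the space of finitely
  supported sequences with support in \<open>{0..N}\<close>.
\<close>

type_synonym rvec = "nat \<Rightarrow>\<^sub>0 real"

definition Wbar :: "nat \<Rightarrow> rvec set" where
  "Wbar N = {w. Poly_Mapping.keys w \<subseteq> {0..N} \<and> (\<Sum>i\<le>N. Poly_Mapping.lookup w i) = 0}"

definition s_coord :: "nat \<Rightarrow> rvec \<Rightarrow> real" where
  "s_coord j w = (\<Sum>i<j. Poly_Mapping.lookup w i)"

definition Oplus :: "nat \<Rightarrow> rvec set" where
  "Oplus N = {w \<in> Wbar N. \<forall>j\<in>{1..N}. s_coord j w \<ge> 0}"

definition e_basis :: "nat \<Rightarrow> rvec" where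
  "e_basis i = Poly_Mapping.single i 1"

definition wt_bar :: "nat \<times> nat \<Rightarrow> rvec" where
  "wt_bar = (\<lambda>(i, j). e_basis i - e_basis j)"

definition nonzero_entries :: "nat \<Rightarrow> 'a::zero mat \<Rightarrow> (nat \<times> nat) set" where
  "nonzero_entries N M = {(i, j). i \<le> N \<and> j \<le> N \<and> M $$ (i, j) \<noteq> 0}"

text \<open>The sum of sets is the Minkowski sum.\<close>

definition corner_polyhedron :: "nat \<Rightarrow> 'a::zero mat \<Rightarrow> rvec set" where
  "corner_polyhedron N M = convex hull (wt_bar ` nonzero_entries N M) + Oplus N"

definition Vert_plus :: "nat \<Rightarrow> 'a::zero mat \<Rightarrow> rvec set" where
  "Vert_plus N M = {v. v extreme_point_of corner_polyhedron N M}"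

definition strictly_upper_triangular :: "'a::zero mat \<Rightarrow> bool" where
  "strictly_upper_triangular M \<longleftrightarrow> (\<forall>i<dim_row M. \<forall>j\<le>i. M $$ (i, j) = 0)"

datatype step = Down | Right

abbreviation downs :: "step list \<Rightarrow> nat" where
  "downs p \<equiv> count_list p Down"

abbreviation rights :: "step list \<Rightarrow> nat" where
  "rights p \<equiv> count_list p Right"

definition grid_path :: "nat \<Rightarrow> step list \<Rightarrow> bool" where
  "grid_path N p \<longleftrightarrow> downs p = N + 1 \<and> rights p = N + 1"

text \<open>
  After \<open>t\<close> steps the path is at the intersection of the horizontal gridline number
  \<open>downs (take t p)\<close> with the vertical gridline number \<open>rights (take t p)\<close>, gridlines being
  numbered from 0; the entry \<open>(i, j)\<close> lies between the horizontal gridlines \<open>i\<close>, \<open>i + 1\<close>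
  and the vertical gridlines \<open>j\<close>, \<open>j + 1\<close>.
\<close>

definition dyck_path :: "nat \<Rightarrow> step list \<Rightarrow> bool" where
  "dyck_path N p \<longleftrightarrow> grid_path N p \<and>
     ((\<forall>t\<le>length p. rights (take t p) \<le> downs (take t p)) \<or>
      (\<forall>t\<le>length p. downs (take t p) \<le> rights (take t p)))"

definition lower_dyck_path :: "nat \<Rightarrow> step list \<Rightarrow> bool" where
  "lower_dyck_path N p \<longleftrightarrow> dyck_path N p \<and> hd p = Down"

definition upper_dyck_path :: "nat \<Rightarrow> step list \<Rightarrow> bool" where
  "upper_dyck_path N p \<longleftrightarrow> dyck_path N p \<and> hd p = Right"

text \<open>
  An entry is above the path if the path passes column \<open>j\<close> along a horizontal gridline
  below that entry.
\<close>

definition entries_above :: "step list \<Rightarrow> (nat \<times> nat) set" where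
  "entries_above p = {(i, j). \<exists>t<length p. p ! t = Right \<and>
     rights (take t p) = j \<and> i < downs (take t p)}"

text \<open>
  The minimizer is unique: the regions above lower (respectively upper) Dyck paths are closed
  under intersection.
\<close>

definition Prof :: "nat \<Rightarrow> 'a::zero mat \<Rightarrow> step list" where
  "Prof N M =
     (if strictly_upper_triangular M
      then ARG_MIN (\<lambda>p. card (entries_above p)) p.
             upper_dyck_path N p \<and> nonzero_entries N M \<subseteq> entries_above p
      else ARG_MIN (\<lambda>p. card (entries_above p)) p.
             lower_dyck_path N p \<and> nonzero_entries N M \<subseteq> entries_above p)"

text \<open>
  \<open>corner_at p t (i, j)\<close>: the steps number \<open>t\<close> and \<open>t + 1\<close> of \<open>p\<close> run along the left side and
  then along the bottom side of the entry \<open>(i, j)\<close>.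
\<close>

definition corner_at :: "step list \<Rightarrow> nat \<Rightarrow> nat \<times> nat \<Rightarrow> bool" where
  "corner_at p t = (\<lambda>(i, j). Suc t < length p \<and> p ! t = Down \<and> p ! Suc t = Right \<and>
     downs (take t p) = i \<and> rights (take t p) = j)"

definition pivotal_entries :: "nat \<Rightarrow> 'a::zero mat \<Rightarrow> (nat \<times> nat) set" where
  "pivotal_entries N M = {x. \<exists>t. corner_at (Prof N M) t x}"

definition offdiag_pivotal_entries :: "nat \<Rightarrow> 'a::zero mat \<Rightarrow> (nat \<times> nat) set" where
  "offdiag_pivotal_entries N M = {(i, j) \<in> pivotal_entries N M. i \<noteq> j}"

definition pivot_order :: "nat \<Rightarrow> 'a::zero mat \<Rightarrow> ((nat \<times> nat) \<times> (nat \<times> nat)) set" where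
  "pivot_order N M =
     {(x, y). \<exists>t u. t \<le> u \<and> corner_at (Prof N M) t x \<and> corner_at (Prof N M) u y}"

definition order_from_pivots ::
    "nat \<Rightarrow> 'a::zero mat \<Rightarrow> (rvec \<times> rvec) set" where
  "order_from_pivots N M =
     {(wt_bar x, wt_bar y) | x y. x \<in> offdiag_pivotal_entries N M \<and>
        y \<in> offdiag_pivotal_entries N M \<and> (x, y) \<in> pivot_order N M}"

definition nonzero_coords :: "nat \<Rightarrow> rvec \<Rightarrow> nat set" where
  "nonzero_coords N w = {j \<in> {1..N}. s_coord j w \<noteq> 0}"

definition order_by_first ::
    "nat \<Rightarrow> 'a::zero mat \<Rightarrow> (rvec \<times> rvec) set" where
  "order_by_first N M = {(v, w). v \<in> Vert_plus N M \<and> w \<in> Vert_plus N M \<and>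
     Min (nonzero_coords N v) \<le> Min (nonzero_coords N w)}"

definition order_by_last ::
    "nat \<Rightarrow> 'a::zero mat \<Rightarrow> (rvec \<times> rvec) set" where
  "order_by_last N M = {(v, w). v \<in> Vert_plus N M \<and> w \<in> Vert_plus N M \<and>
     Max (nonzero_coords N v) \<le> Max (nonzero_coords N w)}"

end

theory Submission
  imports Defs
begin

text \<open>
  In the coordinates \<open>s\<^sub>1, \<dots>, s\<^sub>N\<close> the weight of \<open>(i, j)\<close> is the indicator of the interval
  \<open>(i, j]\<close> if \<open>i < j\<close> and minus the indicator of \<open>(j, i]\<close> if \<open>j < i\<close>.  The vertices of the corner
  polyhedron are the coordinatewise minimal weights: the maximal intervals with sign \<open>-1\<close> if
  there is a nonzero entry below the diagonal, otherwise \<open>0\<close> if there is one on the diagonal,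
  otherwise the minimal intervals with sign \<open>1\<close>.  The region above the profile is the smallest
  one closed under moving up and right that contains the nonzero entries (and, for a lower
  Dyck path, the diagonal and everything above it), so its off-diagonal corners are the nonzero
  entries (strictly below the diagonal, for a lower Dyck path) with no other nonzero entry weakly
  to the lower left, which describes the same intervals.  These
  intervals form an antichain under inclusion, so their left ends, their right ends and their
  positions along the path are ordered in the same way.
\<close>

section \<open>Lattice paths and the entries above them\<close>

lemma entries_above_Nil [simp]: "entries_above [] = {}"
  by (simp add: entries_above_def)

text \<open>\<open>entries_above\<close> looks at prefixes only, so it can be computed from the last
  step: a right step finishes one column, a down step adds nothing. This is why paths are treated by
  induction from the end.\<close>

lemma entries_above_Down [simp]: "entries_above (p @ [Down]) = entries_above p"
  unfolding entries_above_def by (auto simp: Ex_less_Suc nth_append cong: conj_cong)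

lemma entries_above_Right [simp]:
  "entries_above (p @ [Right]) = entries_above p \<union> {..<downs p} \<times> {rights p}"
  unfolding entries_above_def by (auto simp: Ex_less_Suc nth_append cong: conj_cong)

lemma entries_above_bounded: "entries_above p \<subseteq> {..<downs p} \<times> {..<rights p}"
proof (induction p rule: rev_induct)
  case (snoc x p)
  then show ?case by (cases x) (auto simp: less_Suc_eq)
qed simp

text \<open>The column added by a right step takes all rows less than \<open>downs p\<close>, and by
  \<open>entries_above_bounded\<close> no earlier column reaches further down.\<close>

lemma entries_above_column_mono:
  "(i, j) \<in> entries_above p \<Longrightarrow> j \<le> j' \<Longrightarrow> j' < rights p \<Longrightarrow> (i, j') \<in> entries_above p"
proof (induction p rule: rev_induct)
  case (snoc x p)
  then show ?case using entries_above_bounded[of p] by (cases x) (auto simp: less_Suc_eq)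
qed simp

lemma entries_above_row_mono: "(i, j) \<in> entries_above p \<Longrightarrow> i' \<le> i \<Longrightarrow> (i', j) \<in> entries_above p"
  unfolding entries_above_def by auto

section \<open>Dyck paths on either side of the diagonal\<close>

definition below_diagonal :: "step list \<Rightarrow> bool" where
  "below_diagonal p \<longleftrightarrow> (\<forall>t\<le>length p. rights (take t p) \<le> downs (take t p))"

definition above_diagonal :: "step list \<Rightarrow> bool" where
  "above_diagonal p \<longleftrightarrow> (\<forall>t\<le>length p. downs (take t p) \<le> rights (take t p))"

lemma below_diagonal_Nil [simp]: "below_diagonal []"
  by (simp add: below_diagonal_def)

lemma above_diagonal_Nil [simp]: "above_diagonal []"
  by (simp add: above_diagonal_def)

lemma below_diagonal_snoc:
  "below_diagonal (p @ [x]) \<longleftrightarrow> below_diagonal p \<and> rights (p @ [x]) \<le> downs (p @ [x])"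
  unfolding below_diagonal_def by (auto simp: le_Suc_eq)

lemma above_diagonal_snoc:
  "above_diagonal (p @ [x]) \<longleftrightarrow> above_diagonal p \<and> downs (p @ [x]) \<le> rights (p @ [x])"
  unfolding above_diagonal_def by (auto simp: le_Suc_eq)

text \<open>The first step decides between the disjuncts of \<open>dyck_path\<close>: after it one
  count is 1 and the other 0, so \<open>t = 1\<close> refutes one of them. The empty list, where
  \<open>hd\<close> is unspecified, is not a grid path.\<close>

lemma lower_dyck_path_iff: "lower_dyck_path N p \<longleftrightarrow> grid_path N p \<and> below_diagonal p"
proof (cases p)
  case (Cons x q)
  have "\<exists>t\<le>length p. \<not> rights (take t p) \<le> downs (take t p)" if "x = Right"
    by (rule exI[of _ 1]) (use Cons that in auto)
  moreover have "\<exists>t\<le>length p. \<not> downs (take t p) \<le> rights (take t p)" if "x = Down"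
    by (rule exI[of _ 1]) (use Cons that in auto)
  ultimately show ?thesis
    unfolding lower_dyck_path_def dyck_path_def below_diagonal_def
    using Cons by (cases x) auto
qed (auto simp: lower_dyck_path_def dyck_path_def grid_path_def)

lemma upper_dyck_path_iff: "upper_dyck_path N p \<longleftrightarrow> grid_path N p \<and> above_diagonal p"
proof (cases p)
  case (Cons x q)
  have "\<exists>t\<le>length p. \<not> rights (take t p) \<le> downs (take t p)" if "x = Right"
    by (rule exI[of _ 1]) (use Cons that in auto)
  moreover have "\<exists>t\<le>length p. \<not> downs (take t p) \<le> rights (take t p)" if "x = Down"
    by (rule exI[of _ 1]) (use Cons that in auto)
  ultimately show ?thesis
    unfolding upper_dyck_path_def dyck_path_def above_diagonal_def
    using Cons by (cases x) auto
qed (auto simp: upper_dyck_path_def dyck_path_def grid_path_def)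

text \<open>The right step along column \<open>j\<close> ends with \<open>Suc j\<close> right steps
  made; staying weakly below the diagonal forces at least as many down steps before it, so the rows
  up to \<open>j\<close> lie above the path.\<close>

lemma below_diagonal_entries_above:
  "below_diagonal p \<Longrightarrow> i \<le> j \<Longrightarrow> j < rights p \<Longrightarrow> (i, j) \<in> entries_above p"
proof (induction p rule: rev_induct)
  case (snoc x p)
  then show ?case by (cases x) (auto simp: less_Suc_eq below_diagonal_snoc)
qed simp

subsection \<open>Corners\<close>

lemma corner_at_Nil [simp]: "\<not> corner_at [] t x"
  by (cases x) (simp add: corner_at_def)

lemma corner_at_Down [simp]: "corner_at (p @ [Down]) t x \<longleftrightarrow> corner_at p t x"
  by (cases x) (auto simp: corner_at_def nth_append)

lemma corner_at_Right:
  "corner_at (p @ [Right]) t x \<longleftrightarrow> corner_at p t x \<or>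
     p \<noteq> [] \<and> last p = Down \<and> t = length p - 1 \<and> x = (downs p - 1, rights p)"
proof (cases p rule: rev_cases)
  case (snoc q y)
  then show ?thesis
    by (cases x) (auto simp: corner_at_def nth_append less_Suc_eq)
qed (cases x, simp add: corner_at_def)

text \<open>This makes the corners depend on the region alone, so that later no path has to be
  inspected. The disjunct \<open>j = 0\<close> guards against truncated subtraction.\<close>

lemma corner_iff_entries_above:
  "(\<exists>t. corner_at p t (i, j)) \<longleftrightarrow>
     (i, j) \<in> entries_above p \<and> (Suc i, j) \<notin> entries_above p \<and> (j = 0 \<or> (i, j - 1) \<notin> entries_above p)"
proof (induction p rule: rev_induct)
  case (snoc x p)
  note bnd = entries_above_bounded[of p]
  show ?case
  proof (cases x)
    case Right
    \<comment> \<open>If \<open>p\<close> ends with a right step, the column just passed reaches row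
      \<open>downs p - 1\<close>; if it ends with a down step, that row is new and still
      empty.\<close>
    have new: "p \<noteq> [] \<and> last p = Down \<longleftrightarrow>
        downs p > 0 \<and> (rights p = 0 \<or> (downs p - 1, rights p - 1) \<notin> entries_above p)"
    proof (cases p rule: rev_cases)
      case (snoc q y)
      then show ?thesis
        using entries_above_bounded[of q] by (cases y) auto
    qed simp
    show ?thesis
    proof (cases "j = rights p")
      case True
      have "\<not> corner_at p t (i, j)" for t
        using snoc.IH bnd True by auto
      then show ?thesis
        using new bnd unfolding Right True corner_at_Right
        by (cases "downs p") (auto simp: less_Suc_eq)
    next
      case False
      moreover from this bnd have "j - 1 \<noteq> rights p" if "(i, j) \<in> entries_above p"
        using that by auto
      ultimately show ?thesis
        using snoc.IH unfolding Right corner_at_Right by auto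
    qed
  qed (use snoc.IH in simp)
qed simp

text \<open>Every step raises exactly one of the two counts. Hence an entry is a corner at one
  position at most, and the order along the path becomes a comparison of
  \<open>i + j\<close>.\<close>

lemma corner_at_position: "corner_at p t (i, j) \<Longrightarrow> t = i + j"
proof -
  have "downs q + rights q = length q" for q
    by (induction q) (use step.exhaust in auto)
  from this[of "take t p"] show "corner_at p t (i, j) \<Longrightarrow> t = i + j"
    by (auto simp: corner_at_def)
qed

subsection \<open>Realising a region by a path\<close>

text \<open>For monotone \<open>g\<close> with \<open>g 0 = 0\<close>, the value
  \<open>g (Suc j)\<close> is the depth of column \<open>j\<close>: the number of down steps made
  before the right step along it.\<close>

primrec staircase :: "(nat \<Rightarrow> nat) \<Rightarrow> nat \<Rightarrow> step list" where
  "staircase g 0 = []"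
| "staircase g (Suc n) = (staircase g n @ replicate (g (Suc n) - g n) Down) @ [Right]"

lemma replicate_Suc_snoc: "p @ replicate (Suc k) x = (p @ replicate k x) @ [x]"
  by (simp add: replicate_append_same)

lemma count_list_replicate: "count_list (replicate k x) y = (if x = y then k else 0)"
  by (induction k) auto

lemma entries_above_Downs [simp]: "entries_above (p @ replicate k Down) = entries_above p"
proof (induction k)
  case (Suc k)
  then show ?case by (metis replicate_Suc_snoc entries_above_Down)
qed simp

lemma below_diagonal_Downs: "below_diagonal p \<Longrightarrow> below_diagonal (p @ replicate k Down)"
proof (induction k)
  case (Suc k)
  moreover have "rights p \<le> downs p"
    using Suc.prems unfolding below_diagonal_def by force
  ultimately show ?case
    unfolding replicate_Suc_snoc below_diagonal_snoc by (simp add: count_list_replicate)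
qed simp

lemma above_diagonal_Downs:
  "above_diagonal p \<Longrightarrow> downs p + k \<le> rights p \<Longrightarrow> above_diagonal (p @ replicate k Down)"
proof (induction k)
  case (Suc k)
  then show ?case
    unfolding replicate_Suc_snoc above_diagonal_snoc by (simp add: count_list_replicate)
qed simp

lemma staircase_counts:
  assumes "mono g" "g 0 = 0"
  shows "rights (staircase g n) = n" "downs (staircase g n) = g n"
proof (induction n)
  case (Suc n)
  have "g n \<le> g (Suc n)"
    using assms by (simp add: monoD)
  {
    case 1
    show ?case using Suc by (simp add: count_list_replicate)
  next
    case 2
    show ?case using Suc \<open>g n \<le> g (Suc n)\<close> by (simp add: count_list_replicate)
  }
qed (use assms in auto)

lemma entries_above_staircase:
  assumes "mono g" "g 0 = 0"
  shows "entries_above (staircase g n) = {(i, j). j < n \<and> i < g (Suc j)}"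
proof (induction n)
  case (Suc n)
  have "g n \<le> g (Suc n)"
    using assms by (simp add: monoD)
  then show ?case
    using Suc by (auto simp: staircase_counts[OF assms] count_list_replicate less_Suc_eq
        simp del: append_assoc)
qed simp

lemma below_diagonal_staircase:
  assumes "mono g" "g 0 = 0" "\<And>j. j \<le> n \<Longrightarrow> j \<le> g j"
  shows "below_diagonal (staircase g n)"
  using assms(3)
proof (induction n)
  case (Suc n)
  have "g n \<le> g (Suc n)"
    using assms by (simp add: monoD)
  then show ?case
    using Suc.IH Suc.prems[of "Suc n"] Suc.prems
    by (auto simp: below_diagonal_snoc below_diagonal_Downs staircase_counts[OF assms(1,2)]
        count_list_replicate simp del: append_assoc)
qed simp

text \<open>The critical moment is just before the right step along column \<open>j\<close>, with
  \<open>j\<close> right steps and already \<open>g (Suc j)\<close> down steps made; hence the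
  shifted index. For staying below the diagonal it is just after a right step, where
  \<open>g j\<close> is compared with \<open>j\<close>.\<close>

lemma above_diagonal_staircase:
  assumes "mono g" "g 0 = 0" "\<And>j. j < n \<Longrightarrow> g (Suc j) \<le> j"
  shows "above_diagonal (staircase g n)"
  using assms(3)
proof (induction n)
  case (Suc n)
  have "g n \<le> g (Suc n)"
    using assms by (simp add: monoD)
  moreover have "above_diagonal (staircase g n)" "g (Suc n) \<le> n"
    using Suc.IH Suc.prems by auto
  ultimately show ?case
    by (auto simp: above_diagonal_snoc above_diagonal_Downs staircase_counts[OF assms(1,2)]
        count_list_replicate simp del: append_assoc)
qed simp

lemma initial_segment_eq_lessThan_card:
  fixes D :: "nat set"
  assumes "finite D" "\<And>i i'. i \<in> D \<Longrightarrow> i' \<le> i \<Longrightarrow> i' \<in> D"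
  shows "D = {..<card D}"
proof (cases "D = {}")
  case False
  have "D = {..Max D}"
    using assms False by (auto intro: Max_in)
  then show ?thesis
    by (metis card_atMost lessThan_Suc_atMost)
qed simp

locale staircase_region =
  fixes N :: nat and E :: "(nat \<times> nat) set"
  assumes bounded: "E \<subseteq> {..N} \<times> {..N}"
    and row_mono: "(i, j) \<in> E \<Longrightarrow> i' \<le> i \<Longrightarrow> (i', j) \<in> E"
    and column_mono: "(i, j) \<in> E \<Longrightarrow> j \<le> j' \<Longrightarrow> j' \<le> N \<Longrightarrow> (i, j') \<in> E"
begin

text \<open>Collecting the rows of the first \<open>n\<close> columns makes monotonicity and the
  value 0 at 0 immediate. By \<open>column_mono\<close> it is the depth of column
  \<open>n - 1\<close> for \<open>n\<close> from 1 to \<open>N + 1\<close>.\<close>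

definition height :: "nat \<Rightarrow> nat" where
  "height n = card {i. \<exists>j<n. (i, j) \<in> E}"

definition path :: "step list" where
  "path = staircase height (N + 1) @ replicate (N + 1 - height (N + 1)) Down"

lemma finite_column: "finite {i. \<exists>j<n. (i, j) \<in> E}"
  by (rule finite_subset[of _ "{..N}"]) (use bounded in auto)

lemma column_eq: "{i. \<exists>j<n. (i, j) \<in> E} = {..<height n}"
  unfolding height_def
  by (rule initial_segment_eq_lessThan_card[OF finite_column]) (use row_mono in blast)

lemma mono_height: "mono height"
  unfolding height_def by (intro monoI card_mono finite_column) (use less_le_trans in blast)

lemma height_0: "height 0 = 0"
  by (simp add: height_def)

lemma height_le: "height n \<le> N + 1"
proof -
  have "{..<height n} \<subseteq> {..<N + 1}"
    unfolding column_eq[symmetric] using bounded by auto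
  then show ?thesis by (simp only: lessThan_subset_iff)
qed

lemma less_height_Suc: "j \<le> N \<Longrightarrow> i < height (Suc j) \<longleftrightarrow> (i, j) \<in> E"
  using column_eq[of "Suc j"] column_mono[of i _ j] unfolding set_eq_iff less_Suc_eq_le by auto

lemma entries_above_path: "entries_above path = E"
  using bounded
  by (auto simp: path_def entries_above_staircase[OF mono_height height_0] less_height_Suc less_Suc_eq_le
      simp del: staircase.simps)

lemma grid_path_path: "grid_path N path"
  using height_le[of "N + 1"] staircase_counts[OF mono_height height_0, of "N + 1"]
  by (simp add: grid_path_def path_def count_list_replicate del: staircase.simps)

lemma lower_dyck_path_path:
  assumes "\<And>i j. i \<le> j \<Longrightarrow> j \<le> N \<Longrightarrow> (i, j) \<in> E"
  shows "lower_dyck_path N path"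
proof -
  have "j \<le> height j" if "j \<le> N + 1" for j
  proof (cases j)
    case (Suc n)
    then show ?thesis using less_height_Suc[of n n] assms that by auto
  qed simp
  then show ?thesis
    unfolding lower_dyck_path_iff path_def
    using grid_path_path[unfolded path_def]
    by (auto intro!: below_diagonal_Downs below_diagonal_staircase mono_height height_0
        simp del: staircase.simps)
qed

lemma upper_dyck_path_path:
  assumes "\<And>i j. (i, j) \<in> E \<Longrightarrow> i < j"
  shows "upper_dyck_path N path"
proof -
  have "height (Suc j) \<le> j" if "j < N + 1" for j
    using less_height_Suc[of j j] assms[of j j] that by auto
  then show ?thesis
    unfolding upper_dyck_path_iff path_def
    using grid_path_path[unfolded path_def] height_le[of "N + 1"]
    by (auto intro!: above_diagonal_Downs above_diagonal_staircase mono_height height_0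
        simp: staircase_counts[OF mono_height height_0] simp del: staircase.simps)
qed

end

section \<open>Pivotal entries\<close>

definition profile_region :: "nat \<Rightarrow> 'a::zero mat \<Rightarrow> (nat \<times> nat) set" where
  "profile_region N M = {(i, j). j \<le> N \<and> (\<not> strictly_upper_triangular M \<and> i \<le> j \<or>
     (\<exists>(i', j')\<in>nonzero_entries N M. i \<le> i' \<and> j' \<le> j))}"

lemma strictly_upper_triangular_iff:
  assumes "M \<in> carrier_mat (N + 1) (N + 1)"
  shows "strictly_upper_triangular M \<longleftrightarrow> (\<forall>(i, j)\<in>nonzero_entries N M. i < j)"
proof -
  have "strictly_upper_triangular M \<longleftrightarrow> (\<forall>i j. i \<le> N \<longrightarrow> j \<le> i \<longrightarrow> M $$ (i, j) = 0)"
    using assms by (auto simp: strictly_upper_triangular_def less_Suc_eq_le)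
  also have "\<dots> \<longleftrightarrow> (\<forall>(i, j)\<in>nonzero_entries N M. i < j)"
    unfolding nonzero_entries_def by (auto simp flip: not_le dest: le_trans)
  finally show ?thesis .
qed

lemma upper_triangular_iff:
  assumes "M \<in> carrier_mat (N + 1) (N + 1)"
  shows "upper_triangular M \<longleftrightarrow> (\<forall>(i, j)\<in>nonzero_entries N M. i \<le> j)"
proof -
  have "upper_triangular M \<longleftrightarrow> (\<forall>i j. i \<le> N \<longrightarrow> j < i \<longrightarrow> M $$ (i, j) = 0)"
    using assms by (auto simp: upper_triangular_def less_Suc_eq_le)
  also have "\<dots> \<longleftrightarrow> (\<forall>(i, j)\<in>nonzero_entries N M. i \<le> j)"
    unfolding nonzero_entries_def by (auto simp flip: not_less) (meson less_trans)
  finally show ?thesis .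
qed

text \<open>Every admissible path has the region above it, since \<open>entries_above\<close> is
  closed under moving up and right and a lower Dyck path has the diagonal above it. Conversely
  \<open>path\<close> is admissible and realises the region, so a minimiser has at most its
  cardinality, and the inclusion of finite sets becomes an equality.\<close>

lemma entries_above_Prof:
  assumes "M \<in> carrier_mat (N + 1) (N + 1)"
  shows "entries_above (Prof N M) = profile_region N M"
proof -
  let ?S = "nonzero_entries N M" and ?E = "profile_region N M"
  define valid where "valid p \<longleftrightarrow>
    (if strictly_upper_triangular M then upper_dyck_path N p else lower_dyck_path N p) \<and>
    ?S \<subseteq> entries_above p" for p
  have S_le: "i \<le> N \<and> j \<le> N" if "(i, j) \<in> ?S" for i j
    using that by (auto simp: nonzero_entries_def)
  interpret staircase_region N ?E
  proof
    show "?E \<subseteq> {..N} \<times> {..N}"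
      using S_le by (fastforce simp: profile_region_def)
  next
    show "(i', j) \<in> ?E" if "(i, j) \<in> ?E" "i' \<le> i" for i j i'
      using that le_trans unfolding profile_region_def by blast
  next
    show "(i, j') \<in> ?E" if "(i, j) \<in> ?E" "j \<le> j'" "j' \<le> N" for i j j'
      using that le_trans unfolding profile_region_def by blast
  qed
  have "valid path"
  proof (cases "strictly_upper_triangular M")
    case True
    then have "upper_dyck_path N path"
      by (intro upper_dyck_path_path)
        (use strictly_upper_triangular_iff[OF assms] in \<open>fastforce simp: profile_region_def\<close>)
    then show ?thesis
      using S_le True unfolding valid_def entries_above_path by (auto simp: profile_region_def)
  next
    case False
    then have "lower_dyck_path N path"
      by (intro lower_dyck_path_path) (auto simp: profile_region_def)
    then show ?thesis
      using S_le False unfolding valid_def entries_above_path by (auto simp: profile_region_def)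
  qed
  moreover have "Prof N M = (ARG_MIN (\<lambda>p. card (entries_above p)) p. valid p)"
    by (simp add: Prof_def valid_def)
  ultimately have min: "valid (Prof N M)" "card (entries_above (Prof N M)) \<le> card ?E"
    using arg_min_nat_lemma[of valid path "\<lambda>p. card (entries_above p)"]
    by (auto simp: entries_above_path)
  let ?A = "entries_above (Prof N M)"
  have rights: "rights (Prof N M) = N + 1"
    using min(1) by (auto simp: valid_def upper_dyck_path_iff lower_dyck_path_iff grid_path_def
        split: if_splits)
  have "?E \<subseteq> ?A"
  proof (clarify)
    fix i j assume "(i, j) \<in> ?E"
    then consider "j \<le> N" "\<not> strictly_upper_triangular M" "i \<le> j" |
      i' j' where "j \<le> N" "(i', j') \<in> ?S" "i \<le> i'" "j' \<le> j"
      by (auto simp: profile_region_def)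
    then show "(i, j) \<in> ?A"
    proof cases
      case 1
      then show ?thesis
        using min(1) rights by (auto simp: valid_def lower_dyck_path_iff intro: below_diagonal_entries_above)
    next
      case 2
      then have "(i', j') \<in> ?A"
        using min(1) by (auto simp: valid_def)
      then show ?thesis
        using 2 rights by (auto intro: entries_above_row_mono entries_above_column_mono)
    qed
  qed
  moreover have "finite ?A"
    by (rule finite_subset[OF entries_above_bounded]) simp
  ultimately show ?thesis
    using card_seteq min(2) by metis
qed

text \<open>Moving to the lower left weakly decreases every coordinate \<open>s_coord k\<close> of
  the weight, which explains the name.\<close>

definition minimal_entries :: "nat \<Rightarrow> 'a::zero mat \<Rightarrow> (nat \<times> nat) set" where
  "minimal_entries N M = {(i, j) \<in> nonzero_entries N M.
     \<forall>(i', j')\<in>nonzero_entries N M. i \<le> i' \<longrightarrow> j' \<le> j \<longrightarrow> (i', j') = (i, j)}"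

lemma offdiag_pivotal_entries_eq:
  assumes "M \<in> carrier_mat (N + 1) (N + 1)"
  shows "offdiag_pivotal_entries N M =
    {(i, j) \<in> minimal_entries N M. i \<noteq> j \<and> (\<not> strictly_upper_triangular M \<longrightarrow> j < i)}"
proof -
  let ?S = "nonzero_entries N M" and ?E = "profile_region N M"
  have S_le: "j \<le> N" if "(i, j) \<in> ?S" for i j
    using that by (auto simp: nonzero_entries_def)
  have "(i, j) \<in> ?E \<and> (Suc i, j) \<notin> ?E \<and> (j = 0 \<or> (i, j - 1) \<notin> ?E) \<longleftrightarrow>
      (i, j) \<in> minimal_entries N M \<and> (\<not> strictly_upper_triangular M \<longrightarrow> j < i)"
    (is "?L \<longleftrightarrow> ?R") if "i \<noteq> j" for i j
  proof
    assume L: ?L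
    \<comment> \<open>For a lower Dyck path, \<open>i < j\<close> would put
      \<open>(Suc i, j)\<close> into the region.\<close>
    then have "j \<le> N" and lower: "\<not> strictly_upper_triangular M \<longrightarrow> j < i"
      using that by (auto simp: profile_region_def)
    \<comment> \<open>An entry strictly further down would put \<open>(Suc i, j)\<close> into the
      region, one strictly further left would put \<open>(i, j - 1)\<close> there.\<close>
    have min: "(i', j') = (i, j)" if "(i', j') \<in> ?S" "i \<le> i'" "j' \<le> j" for i' j'
    proof -
      have "\<not> Suc i \<le> i'"
        using L that \<open>j \<le> N\<close> by (auto simp: profile_region_def)
      moreover have "\<not> j' < j"
        using L that \<open>j \<le> N\<close> by (fastforce simp: profile_region_def)
      ultimately show ?thesis using that by simp
    qed
    \<comment> \<open>By \<open>lower\<close>, \<open>(i, j)\<close> is not in the region on account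
      of the diagonal, so some nonzero entry is responsible.\<close>
    moreover obtain i' j' where "(i', j') \<in> ?S" "i \<le> i'" "j' \<le> j"
      using L lower by (auto simp: profile_region_def)
    ultimately show ?R
      using lower by (auto simp: minimal_entries_def)
  next
    assume R: ?R
    then have S: "(i, j) \<in> ?S" and "j \<le> N"
      using S_le by (auto simp: minimal_entries_def)
    then have "(i, j) \<in> ?E"
      by (auto simp: profile_region_def)
    moreover have "(Suc i, j) \<notin> ?E"
      using R by (fastforce simp: profile_region_def minimal_entries_def)
    moreover have "j = 0 \<or> (i, j - 1) \<notin> ?E"
      using R by (fastforce simp: profile_region_def minimal_entries_def)
    ultimately show ?L by blast
  qed
  then show ?thesis
    by (auto simp: offdiag_pivotal_entries_def pivotal_entries_def corner_iff_entries_above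
        entries_above_Prof[OF assms])
qed

section \<open>Vertices of the corner polyhedron\<close>

lemma lookup_scaleR [simp]: "Poly_Mapping.lookup (c *\<^sub>R w) i = c *\<^sub>R Poly_Mapping.lookup w i"
proof -
  have "finite {i. c *\<^sub>R Poly_Mapping.lookup w i \<noteq> 0}"
    by (rule finite_subset[OF _ finite_keys[of w]]) (auto simp: in_keys_iff)
  then show ?thesis
    by (simp add: scaleR_poly_mapping_def)
qed

lemma s_coord_zero [simp]: "s_coord k 0 = 0"
  by (simp add: s_coord_def)

lemma s_coord_add [simp]: "s_coord k (v + w) = s_coord k v + s_coord k w"
  by (simp add: s_coord_def lookup_add sum.distrib)

lemma s_coord_diff [simp]: "s_coord k (v - w) = s_coord k v - s_coord k w"
  by (simp add: s_coord_def lookup_minus sum_subtractf)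

lemma s_coord_scaleR [simp]: "s_coord k (c *\<^sub>R w) = c * s_coord k w"
  by (simp add: s_coord_def sum_distrib_left)

lemma s_coord_wt_bar [simp]: "s_coord k (wt_bar (i, j)) = of_bool (i < k) - of_bool (j < k)"
  by (simp add: s_coord_def wt_bar_def e_basis_def lookup_minus lookup_single when_def sum_subtractf)

lemma wt_bar_diag [simp]: "wt_bar (i, i) = 0"
  by (simp add: wt_bar_def)

text \<open>All diagonal entries share the weight 0. Off the diagonal the entry is read off from the
  places of \<open>+1\<close> and \<open>-1\<close>.\<close>

lemma wt_bar_inj:
  assumes "wt_bar (i, j) = wt_bar (i', j')" "i \<noteq> j"
  shows "(i', j') = (i, j)"
proof -
  have "Poly_Mapping.lookup (wt_bar (i, j)) k = Poly_Mapping.lookup (wt_bar (i', j')) k" for k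
    using assms(1) by simp
  from this[of i] this[of j] show ?thesis
    using assms(2)
    by (auto simp: wt_bar_def e_basis_def lookup_minus lookup_single when_def split: if_splits)
qed

lemma Wbar_diff: "v \<in> Wbar N \<Longrightarrow> w \<in> Wbar N \<Longrightarrow> v - w \<in> Wbar N"
  using keys_diff[of v w] by (auto simp: Wbar_def lookup_minus sum_subtractf)

lemma wt_bar_in_Wbar: "i \<le> N \<Longrightarrow> j \<le> N \<Longrightarrow> wt_bar (i, j) \<in> Wbar N"
  using keys_diff[of "Poly_Mapping.single i (1::real)" "Poly_Mapping.single j 1"]
  by (auto simp: Wbar_def wt_bar_def e_basis_def lookup_minus sum_subtractf lookup_single when_def
      split: if_splits)

lemma zero_in_Oplus [simp]: "0 \<in> Oplus N"
  by (auto simp: Oplus_def Wbar_def)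

lemma Oplus_add: "v \<in> Oplus N \<Longrightarrow> w \<in> Oplus N \<Longrightarrow> v + w \<in> Oplus N"
  using keys_add[of v w] by (auto simp: Oplus_def Wbar_def lookup_add sum.distrib)

text \<open>The partial sums with 0 and \<open>N + 1\<close> terms vanish as well, the latter by
  membership in \<open>Wbar N\<close>, and each entry is a difference of consecutive partial
  sums.\<close>

lemma Wbar_eq_0:
  assumes "w \<in> Wbar N" "\<And>k. k \<in> {1..N} \<Longrightarrow> s_coord k w = 0"
  shows "w = 0"
proof (rule poly_mapping_eqI)
  fix i
  have "s_coord k w = 0" if k: "k \<le> Suc N" for k
  proof -
    consider "k = 0" | "k \<in> {1..N}" | "k = Suc N"
      using k by (cases "k = Suc N"; cases "k = 0") auto
    then show ?thesis
      by cases (use assms in \<open>auto simp: s_coord_def Wbar_def lessThan_Suc_atMost\<close>)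
  qed
  from this[of i] this[of "Suc i"] have "Poly_Mapping.lookup w i = 0" if "i \<le> N"
    using that by (simp add: s_coord_def)
  moreover have "Poly_Mapping.lookup w i = 0" if "\<not> i \<le> N"
    using that assms(1) by (auto simp: Wbar_def in_keys_iff)
  ultimately show "Poly_Mapping.lookup w i = Poly_Mapping.lookup 0 i"
    by auto
qed

section \<open>Criteria for extreme points and for vertices\<close>

lemma extreme_point_ofI_linear:
  fixes f :: "'a::real_vector \<Rightarrow> real"
  assumes "linear f" "v \<in> P" "\<And>x. x \<in> P \<Longrightarrow> x \<noteq> v \<Longrightarrow> f v < f x"
  shows "v extreme_point_of P"
proof -
  have False if "a \<in> P" "b \<in> P" "v \<in> open_segment a b" for a b
  proof -
    obtain u where u: "0 < u" "u < 1" "v = (1 - u) *\<^sub>R a + u *\<^sub>R b" and "a \<noteq> b"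
      using \<open>v \<in> open_segment a b\<close> by (auto simp: in_segment)
    have "f v = (1 - u) * f a + u * f b"
      using assms(1) u(3) by (simp add: linear_add linear_scale)
    \<comment> \<open>\<open>f v\<close> is a proper mean of \<open>f a\<close> and
      \<open>f b\<close>, neither of which is below it. So both summands vanish and both endpoints
      would be \<open>v\<close>.\<close>
    then have *: "(1 - u) * (f a - f v) + u * (f b - f v) = 0"
      by (simp add: algebra_simps)
    have "f v \<le> f a" "f v \<le> f b"
      using assms(3) that by (metis less_imp_le order_refl)+
    then have "(1 - u) * (f a - f v) \<ge> 0" "u * (f b - f v) \<ge> 0"
      using u by auto
    with * have "(1 - u) * (f a - f v) = 0" "u * (f b - f v) = 0"
      by linarith+
    then have "f a = f v" "f b = f v"
      using u by auto
    then show False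
      using assms(3) that \<open>a \<noteq> b\<close> by (metis less_irrefl)
  qed
  then show ?thesis
    using assms(2) by (auto simp: extreme_point_of_def)
qed

text \<open>Carries strict minimality at \<open>v\<close> from the generators to their convex
  hull.\<close>

lemma convex_insert_strict_halfspace:
  fixes f :: "'a::real_vector \<Rightarrow> real"
  assumes "linear f"
  shows "convex {x. x = v \<or> f v < f x}"
proof (rule convexI)
  fix x y and t u :: real
  assume *: "x \<in> {x. x = v \<or> f v < f x}" "y \<in> {x. x = v \<or> f v < f x}" "0 \<le> t" "0 \<le> u" "t + u = 1"
  show "t *\<^sub>R x + u *\<^sub>R y \<in> {x. x = v \<or> f v < f x}"
  proof (cases "t = 0 \<or> u = 0 \<or> x = v \<and> y = v")
    case True
    then show ?thesis
      using * by (auto simp flip: scaleR_add_left)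
  next
    case False
    have "t * (f x - f v) + u * (f y - f v) > 0"
    proof (cases "x = v")
      case True
      then show ?thesis using * False by auto
    next
      case False': False
      then have "t * (f x - f v) > 0" "u * (f y - f v) \<ge> 0"
        using * False by auto
      then show ?thesis by simp
    qed
    moreover have "f v = t * f v + u * f v"
      using *(5) by (simp flip: distrib_right)
    moreover have "f (t *\<^sub>R x + u *\<^sub>R y) = t * f x + u * f y"
      using assms by (simp add: linear_add linear_scale)
    ultimately show ?thesis
      by (simp add: algebra_simps)
  qed
qed

text \<open>
  The functional with weight \<open>N + 1\<close> on the coordinates in \<open>H\<close> and weight \<open>1\<close> on the others
  attains its minimum over the corner polyhedron only at \<open>v\<close>: a gain of \<open>1\<close> on a heavy
  coordinate outweighs a loss of at most \<open>1\<close> on each light one.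
\<close>

lemma Vert_plusI:
  assumes v: "v \<in> wt_bar ` nonzero_entries N M"
    and H: "H \<subseteq> {1..N}"
    and le: "\<And>x k. x \<in> nonzero_entries N M \<Longrightarrow> k \<in> {1..N} \<Longrightarrow>
      s_coord k v \<le> s_coord k (wt_bar x) + of_bool (k \<notin> H)"
    and less: "\<And>x. x \<in> nonzero_entries N M \<Longrightarrow> wt_bar x \<noteq> v \<Longrightarrow>
      \<exists>k\<in>H. s_coord k v + 1 \<le> s_coord k (wt_bar x)"
  shows "v \<in> Vert_plus N M"
proof -
  define c where "c k = (if k \<in> H then real N + 1 else 1)" for k
  define f where "f w = (\<Sum>k\<in>{1..N}. c k * s_coord k w)" for w
  have c_pos: "c k > 0" for k
    by (simp add: c_def)
  have f_linear: "linear f"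
    by (rule linearI) (simp_all add: f_def sum.distrib algebra_simps sum_distrib_left)
  have f_Oplus: "f w > 0" if w: "w \<in> Oplus N" "w \<noteq> 0" for w
  proof -
    obtain k where "k \<in> {1..N}" "s_coord k w \<noteq> 0"
      using w Wbar_eq_0[of w N] unfolding Oplus_def by blast
    moreover have nonneg: "s_coord k w \<ge> 0" if "k \<in> {1..N}" for k
      using \<open>w \<in> Oplus N\<close> that by (simp add: Oplus_def)
    ultimately show ?thesis
      unfolding f_def using c_pos
      by (intro sum_pos2[of _ k]) (auto simp: less_le)
  qed
  have f_wt: "f v < f (wt_bar x)" if x: "x \<in> nonzero_entries N M" "wt_bar x \<noteq> v" for x
  proof -
    let ?d = "\<lambda>k. s_coord k (wt_bar x) - s_coord k v"
    obtain k0 where k0: "k0 \<in> H" "?d k0 \<ge> 1"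
      using less[OF x] by (metis add.commute le_diff_eq)
    \<comment> \<open>Coordinate \<open>k0\<close> contributes at least \<open>N + 1\<close> and
      every other one at least \<open>-1\<close>; these bounds add up to
      \<open>(N + 2) - N = 2\<close>, which is positive.\<close>
    have "(if k = k0 then real N + 2 else 0) - 1 \<le> c k * ?d k" if k: "k \<in> {1..N}" for k
    proof (cases "k \<in> H")
      case True
      have d: "0 \<le> ?d k"
        using le[OF x(1) k] True by simp
      show ?thesis
      proof (cases "k = k0")
        case k: True
        then have "(if k = k0 then real N + 2 else 0) - 1 = (real N + 1) * 1"
          by simp
        also have "\<dots> \<le> (real N + 1) * ?d k"
          using k0 k by (intro mult_left_mono) auto
        also have "\<dots> = c k * ?d k"
          using True by (simp add: c_def)
        finally show ?thesis .
      next
        case False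
        then show ?thesis
          using mult_nonneg_nonneg[OF less_imp_le[OF c_pos[of k]] d] by simp
      qed
    next
      case False
      then show ?thesis using k0 le[OF x(1) k] by (auto simp: c_def)
    qed
    then have "(\<Sum>k\<in>{1..N}. (if k = k0 then real N + 2 else 0) - 1) \<le> (\<Sum>k\<in>{1..N}. c k * ?d k)"
      by (intro sum_mono)
    moreover have "k0 \<in> {1..N}"
      using k0 H by auto
    ultimately show ?thesis
      by (simp add: f_def sum_subtractf right_diff_distrib)
  qed
  have hull: "x = v \<or> f v < f x" if "x \<in> convex hull (wt_bar ` nonzero_entries N M)" for x
  proof -
    have "convex hull (wt_bar ` nonzero_entries N M) \<subseteq> {x. x = v \<or> f v < f x}"
      by (intro hull_minimal convex_insert_strict_halfspace f_linear) (use f_wt in auto)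
    then show ?thesis using that by auto
  qed
  have "v extreme_point_of corner_polyhedron N M"
  proof (rule extreme_point_ofI_linear[OF f_linear])
    have "v + 0 \<in> corner_polyhedron N M"
      unfolding corner_polyhedron_def using v by (intro set_plus_intro hull_inc) auto
    then show "v \<in> corner_polyhedron N M" by simp
  next
    fix x assume "x \<in> corner_polyhedron N M" "x \<noteq> v"
    then obtain a b where ab: "x = a + b" "a \<in> convex hull (wt_bar ` nonzero_entries N M)" "b \<in> Oplus N"
      by (auto simp: corner_polyhedron_def elim: set_plus_elim)
    moreover have "f x = f a + f b"
      using f_linear ab by (simp add: linear_add)
    moreover have "f 0 = 0"
      using f_linear by (rule linear_0)
    ultimately show "f v < f x"
      using hull[of a] f_Oplus[of b] \<open>x \<noteq> v\<close> by (cases "b = 0") auto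
  qed
  then show ?thesis by (simp add: Vert_plus_def)
qed

text \<open>Otherwise \<open>v\<close> is the midpoint of a nondegenerate segment in
  \<open>P\<close>.\<close>

lemma extreme_point_of_symmetric_translates:
  assumes "v extreme_point_of P" "v - d \<in> P" "v + d \<in> P"
  shows "d = 0"
proof (rule ccontr)
  assume "d \<noteq> 0"
  have "v = (1 - 1/2) *\<^sub>R (v - d) + (1/2) *\<^sub>R (v + d)"
    by (simp add: algebra_simps flip: scaleR_add_left)
  moreover have "v - d \<noteq> v + d"
  proof
    assume "v - d = v + d"
    then have "2 *\<^sub>R d = 0"
      by (simp add: scaleR_2 algebra_simps)
    then show False using \<open>d \<noteq> 0\<close> by simp
  qed
  ultimately have "v \<in> open_segment (v - d) (v + d)"
    unfolding in_segment by (intro conjI exI[of _ "1/2"]) auto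
  then show False
    using assms by (auto simp: extreme_point_of_def)
qed

text \<open>Write \<open>v = a + b\<close> with \<open>b\<close> in the cone:
  \<open>v - b = a\<close> and \<open>v + b = a + (b + b)\<close> lie in the polyhedron, so
  \<open>b = 0\<close> and \<open>v\<close> is a generator. If a weight \<open>w\<close> is
  coordinatewise below \<open>v\<close>, then \<open>v - w\<close> lies in the cone and the same
  argument with \<open>d = v - w\<close> gives \<open>w = v\<close>.\<close>

lemma Vert_plusE:
  assumes "v \<in> Vert_plus N M"
  obtains i j where "(i, j) \<in> nonzero_entries N M" "v = wt_bar (i, j)"
    "\<forall>i' j'. (i', j') \<in> nonzero_entries N M \<longrightarrow>
       (\<forall>k\<in>{1..N}. s_coord k (wt_bar (i', j')) \<le> s_coord k v) \<longrightarrow> wt_bar (i', j') = v"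
proof -
  let ?G = "wt_bar ` nonzero_entries N M"
  have ext: "v extreme_point_of corner_polyhedron N M"
    using assms by (simp add: Vert_plus_def)
  have P: "a + b \<in> corner_polyhedron N M" if "a \<in> convex hull ?G" "b \<in> Oplus N" for a b
    using that by (auto simp: corner_polyhedron_def intro: set_plus_intro)
  obtain a b where ab: "v = a + b" "a \<in> convex hull ?G" "b \<in> Oplus N"
    using ext by (auto simp: extreme_point_of_def corner_polyhedron_def elim: set_plus_elim)
  have "b = 0"
    by (rule extreme_point_of_symmetric_translates[OF ext])
      (use P[OF ab(2) zero_in_Oplus] P[OF ab(2) Oplus_add[OF ab(3) ab(3)]] ab(1) in \<open>auto simp: add.assoc\<close>)
  then have v_hull: "v \<in> convex hull ?G"
    using ab by simp
  moreover have "convex hull ?G \<subseteq> corner_polyhedron N M"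
    using P[OF _ zero_in_Oplus] by auto
  ultimately have "v extreme_point_of convex hull ?G"
    using ext by (auto simp: extreme_point_of_def)
  then obtain i j where ij: "(i, j) \<in> nonzero_entries N M" "v = wt_bar (i, j)"
    using extreme_point_of_convex_hull by fast
  show thesis
  proof (rule that[OF ij], intro allI impI)
    fix i' j' assume y: "(i', j') \<in> nonzero_entries N M"
      and le: "\<forall>k\<in>{1..N}. s_coord k (wt_bar (i', j')) \<le> s_coord k v"
    have "v - wt_bar (i', j') \<in> Wbar N"
      using ij y by (auto simp: nonzero_entries_def intro!: Wbar_diff wt_bar_in_Wbar)
    then have d: "v - wt_bar (i', j') \<in> Oplus N"
      using le by (auto simp: Oplus_def)
    have "wt_bar (i', j') \<in> convex hull ?G"
      using y by (intro hull_inc) auto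
    then have "v - wt_bar (i', j') = 0"
      using P[OF _ zero_in_Oplus, of "wt_bar (i', j')"] P[OF v_hull d]
      by (intro extreme_point_of_symmetric_translates[OF ext]) auto
    then show "wt_bar (i', j') = v" by simp
  qed
qed

section \<open>The vertices in the three cases\<close>

lemma Vert_plus_of_entry_below_diagonal:
  assumes "(a, b) \<in> nonzero_entries N M" "b < a"
  shows "Vert_plus N M = wt_bar ` {(i, j) \<in> minimal_entries N M. j < i}"
proof (intro equalityI subsetI)
  fix v assume "v \<in> Vert_plus N M"
  then obtain i j where ij: "(i, j) \<in> nonzero_entries N M" "v = wt_bar (i, j)" and
    min: "\<forall>i' j'. (i', j') \<in> nonzero_entries N M \<longrightarrow>
      (\<forall>k\<in>{1..N}. s_coord k (wt_bar (i', j')) \<le> s_coord k v) \<longrightarrow> wt_bar (i', j') = v"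
    by (rule Vert_plusE)
  have "j < i"
  proof (rule ccontr)
    assume "\<not> j < i"
    \<comment> \<open>The weight of \<open>(a, b)\<close> has no positive coordinate and
      \<open>v\<close> no negative one, so minimality makes them equal; but coordinate
      \<open>a\<close> of the former is \<open>-1\<close>.\<close>
    then have "wt_bar (a, b) = v"
      using assms ij(2) by (intro min[rule_format]) auto
    then have "s_coord a (wt_bar (a, b)) = s_coord a v"
      by simp
    then show False
      using assms(2) ij(2) \<open>\<not> j < i\<close> by (auto simp: of_bool_def split: if_splits)
  qed
  moreover have "(i', j') = (i, j)" if "(i', j') \<in> nonzero_entries N M" "i \<le> i'" "j' \<le> j" for i' j'
  proof -
    have "wt_bar (i', j') = v"
      using that ij(2) by (intro min[rule_format]) auto
    then show ?thesis
      using wt_bar_inj[of i j i' j'] ij(2) \<open>j < i\<close> by simp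
  qed
  ultimately show "v \<in> wt_bar ` {(i, j) \<in> minimal_entries N M. j < i}"
    using ij by (auto simp: minimal_entries_def)
next
  fix v assume "v \<in> wt_bar ` {(i, j) \<in> minimal_entries N M. j < i}"
  then obtain i j where v: "v = wt_bar (i, j)" "j < i" and ij: "(i, j) \<in> minimal_entries N M"
    by auto
  show "v \<in> Vert_plus N M"
  \<comment> \<open>On \<open>H\<close> the vector \<open>v\<close> has the least possible value
    \<open>-1\<close>. Elsewhere it is 0, so another weight is lower by at most 1.\<close>
  proof (rule Vert_plusI[where H = "{j<..i}"])
    show "v \<in> wt_bar ` nonzero_entries N M"
      using v ij by (auto simp: minimal_entries_def)
    show "{j<..i} \<subseteq> {1..N}"
      using ij by (auto simp: minimal_entries_def nonzero_entries_def)
  next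
    fix x k
    show "s_coord k v \<le> s_coord k (wt_bar x) + of_bool (k \<notin> {j<..i})"
      using v by (cases x) auto
  next
    fix x assume x: "x \<in> nonzero_entries N M" "wt_bar x \<noteq> v"
    obtain i' j' where [simp]: "x = (i', j')"
      by (cases x)
    have "\<not> (i \<le> i' \<and> j' \<le> j)"
      using x v ij by (auto simp: minimal_entries_def)
    then consider "i' < i" | "j < j'"
      by linarith
    then show "\<exists>k\<in>{j<..i}. s_coord k v + 1 \<le> s_coord k (wt_bar x)"
    proof cases
      case 1
      then show ?thesis using v by (intro bexI[of _ i]) auto
    next
      case 2
      then show ?thesis using v by (intro bexI[of _ "Suc j"]) auto
    qed
  qed
qed

lemma Vert_plus_of_entries_above_diagonal:
  assumes "\<And>i j. (i, j) \<in> nonzero_entries N M \<Longrightarrow> i < j"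
  shows "Vert_plus N M = wt_bar ` minimal_entries N M"
proof (intro equalityI subsetI)
  fix v assume "v \<in> Vert_plus N M"
  then obtain i j where ij: "(i, j) \<in> nonzero_entries N M" "v = wt_bar (i, j)" and
    min: "\<forall>i' j'. (i', j') \<in> nonzero_entries N M \<longrightarrow>
      (\<forall>k\<in>{1..N}. s_coord k (wt_bar (i', j')) \<le> s_coord k v) \<longrightarrow> wt_bar (i', j') = v"
    by (rule Vert_plusE)
  have "(i', j') = (i, j)" if "(i', j') \<in> nonzero_entries N M" "i \<le> i'" "j' \<le> j" for i' j'
  proof -
    have "wt_bar (i', j') = v"
      using that ij(2) by (intro min[rule_format]) auto
    then show ?thesis
      using wt_bar_inj[of i j i' j'] ij assms[of i j] by simp
  qed
  then show "v \<in> wt_bar ` minimal_entries N M"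
    using ij by (auto simp: minimal_entries_def)
next
  fix v assume "v \<in> wt_bar ` minimal_entries N M"
  then obtain i j where v: "v = wt_bar (i, j)" and ij: "(i, j) \<in> minimal_entries N M"
    by auto
  have "i < j"
    using ij assms by (auto simp: minimal_entries_def)
  show "v \<in> Vert_plus N M"
  \<comment> \<open>Here all weights are nonnegative: \<open>v\<close> is 0 on \<open>H\<close> and
    1 on the light coordinates. A competitor's interval leaves that of \<open>v\<close> at its first
    point \<open>Suc i'\<close> or at its last point \<open>j'\<close>.\<close>
  proof (rule Vert_plusI[where H = "{1..N} - {i<..j}"])
    show "v \<in> wt_bar ` nonzero_entries N M"
      using v ij by (auto simp: minimal_entries_def)
  next
    fix x k assume x: "x \<in> nonzero_entries N M" "k \<in> {1..N}"
    obtain i' j' where [simp]: "x = (i', j')"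
      by (cases x)
    have "i' < j'"
      using x assms by simp
    then show "s_coord k v \<le> s_coord k (wt_bar x) + of_bool (k \<notin> {1..N} - {i<..j})"
      using v x(2) by auto
  next
    fix x assume x: "x \<in> nonzero_entries N M" "wt_bar x \<noteq> v"
    obtain i' j' where [simp]: "x = (i', j')"
      by (cases x)
    have "i' < j'" "j' \<le> N"
      using x assms by (auto simp: nonzero_entries_def)
    have "\<not> (i \<le> i' \<and> j' \<le> j)"
      using x v ij by (auto simp: minimal_entries_def)
    then consider "i' < i" | "j < j'"
      by linarith
    then show "\<exists>k\<in>{1..N} - {i<..j}. s_coord k v + 1 \<le> s_coord k (wt_bar x)"
    proof cases
      case 1
      then show ?thesis
        using v \<open>i < j\<close> \<open>i' < j'\<close> \<open>j' \<le> N\<close> by (intro bexI[of _ "Suc i'"]) auto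
    next
      case 2
      then show ?thesis
        using v \<open>i < j\<close> \<open>i' < j'\<close> \<open>j' \<le> N\<close> by (intro bexI[of _ j']) auto
    qed
  qed auto
qed

text \<open>A diagonal entry has weight 0, and all other weights are coordinatewise nonnegative, so
  0 lies below every generator.\<close>

lemma Vert_plus_upper_triangular:
  assumes "\<And>i j. (i, j) \<in> nonzero_entries N M \<Longrightarrow> i \<le> j" "(a, a) \<in> nonzero_entries N M"
  shows "Vert_plus N M = {0}"
proof -
  have "v = 0" if "v \<in> Vert_plus N M" for v
  proof -
    obtain i j where ij: "(i, j) \<in> nonzero_entries N M" "v = wt_bar (i, j)" and
      min: "\<forall>i' j'. (i', j') \<in> nonzero_entries N M \<longrightarrow>
        (\<forall>k\<in>{1..N}. s_coord k (wt_bar (i', j')) \<le> s_coord k v) \<longrightarrow> wt_bar (i', j') = v"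
      using \<open>v \<in> Vert_plus N M\<close> by (rule Vert_plusE)
    have "wt_bar (a, a) = v"
      using assms(2) assms(1)[OF ij(1)] ij(2) by (intro min[rule_format]) auto
    then show ?thesis by simp
  qed
  moreover have "0 \<in> Vert_plus N M"
  proof (rule Vert_plusI[where H = "{1..N}"])
    show "0 \<in> wt_bar ` nonzero_entries N M"
      using assms(2) wt_bar_diag[of a] by (metis image_eqI)
  next
    fix x k assume x: "x \<in> nonzero_entries N M"
    obtain i j where [simp]: "x = (i, j)"
      by (cases x)
    have "i \<le> j"
      using x assms(1) by simp
    then show "s_coord k 0 \<le> s_coord k (wt_bar x) + of_bool (k \<notin> {1..N})"
      by auto
  next
    fix x assume x: "x \<in> nonzero_entries N M" "wt_bar x \<noteq> 0"
    obtain i j where [simp]: "x = (i, j)"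
      by (cases x)
    have "i < j" "j \<le> N"
      using x assms(1)[of i j] by (auto simp: nonzero_entries_def le_less)
    then show "\<exists>k\<in>{1..N}. s_coord k 0 + 1 \<le> s_coord k (wt_bar x)"
      by (intro bexI[of _ j]) auto
  qed simp
  ultimately show ?thesis by auto
qed

section \<open>The canonical ordering\<close>

lemma nonzero_coords_wt_bar:
  assumes "i \<le> N" "j \<le> N"
  shows "nonzero_coords N (wt_bar (i, j)) = {min i j<..max i j}"
  using assms by (auto simp: nonzero_coords_def)

lemma linear_order_on_inj:
  fixes m :: "'a \<Rightarrow> 'b::linorder"
  assumes "inj_on m V"
  shows "linear_order_on V {(v, w). v \<in> V \<and> w \<in> V \<and> m v \<le> m w}"
  unfolding order_on_defs refl_on_def trans_def antisym_def total_on_def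
  using inj_onD[OF assms] by (auto dest: antisym)

text \<open>All three orders reduce to comparing columns. By \<open>same_side\<close>,
  \<open>min i j\<close> is the row for all pivots or the column for all, and \<open>max i j\<close>
  is the other index.\<close>

lemma vertex_orders_agree:
  assumes Vert: "Vert_plus N M = wt_bar ` offdiag_pivotal_entries N M"
    and minimal: "offdiag_pivotal_entries N M \<subseteq> minimal_entries N M"
    and same_side: "(\<forall>(i, j)\<in>offdiag_pivotal_entries N M. i < j) \<or>
      (\<forall>(i, j)\<in>offdiag_pivotal_entries N M. j < i)"
  shows "bij_betw wt_bar (offdiag_pivotal_entries N M) (Vert_plus N M)"
    and "\<forall>v\<in>Vert_plus N M. nonzero_coords N v \<noteq> {}"
    and "linear_order_on (Vert_plus N M) (order_by_first N M)"
    and "order_by_first N M = order_from_pivots N M"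
    and "order_by_first N M = order_by_last N M"
proof -
  let ?A = "offdiag_pivotal_entries N M"
  have A: "i \<noteq> j \<and> i \<le> N \<and> j \<le> N" if "(i, j) \<in> ?A" for i j
    using that minimal by (auto simp: offdiag_pivotal_entries_def minimal_entries_def nonzero_entries_def)
  have antichain: "(i', j') = (i, j)" if "(i, j) \<in> ?A" "(i', j') \<in> ?A" "i \<le> i'" "j' \<le> j" for i j i' j'
  proof -
    have "(i, j) \<in> minimal_entries N M" "(i', j') \<in> nonzero_entries N M"
      using that minimal by (auto simp: minimal_entries_def)
    then show ?thesis
      using that unfolding minimal_entries_def by blast
  qed
  \<comment> \<open>In an antichain for the lower-left order, rows and columns increase together,
    hence so does their sum.\<close>
  have ord: "(i \<le> i' \<longleftrightarrow> j \<le> j') \<and> (i + j \<le> i' + j' \<longleftrightarrow> j \<le> j')" if "(i, j) \<in> ?A" "(i', j') \<in> ?A" for i j i' j'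
    using antichain[of i j i' j'] antichain[of i' j' i j] that by fastforce
  have Min: "Min (nonzero_coords N (wt_bar (i, j))) = Suc (min i j)" if "(i, j) \<in> ?A" for i j
    using A[OF that] by (intro Min_eqI) (auto simp: nonzero_coords_wt_bar)
  have Max: "Max (nonzero_coords N (wt_bar (i, j))) = max i j" if "(i, j) \<in> ?A" for i j
    using A[OF that] by (intro Max_eqI) (auto simp: nonzero_coords_wt_bar)
  have Min_le: "Min (nonzero_coords N (wt_bar x)) \<le> Min (nonzero_coords N (wt_bar y)) \<longleftrightarrow> snd x \<le> snd y"
    if "x \<in> ?A" "y \<in> ?A" for x y
    using that same_side ord[of "fst x" "snd x" "fst y" "snd y"]
    by (cases x; cases y) (fastforce simp: Min)
  have Max_le: "Max (nonzero_coords N (wt_bar x)) \<le> Max (nonzero_coords N (wt_bar y)) \<longleftrightarrow> snd x \<le> snd y"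
    if "x \<in> ?A" "y \<in> ?A" for x y
    using that same_side ord[of "fst x" "snd x" "fst y" "snd y"]
    by (cases x; cases y) (fastforce simp: Max)
  have pivot_le: "(x, y) \<in> pivot_order N M \<longleftrightarrow> snd x \<le> snd y" if xy: "x \<in> ?A" "y \<in> ?A" for x y
  proof -
    obtain i j i' j' where [simp]: "x = (i, j)" "y = (i', j')"
      by (cases x; cases y)
    obtain t u where "corner_at (Prof N M) t x" "corner_at (Prof N M) u y"
      using xy by (auto simp: offdiag_pivotal_entries_def pivotal_entries_def)
    then have "(x, y) \<in> pivot_order N M \<longleftrightarrow> i + j \<le> i' + j'"
      by (auto simp: pivot_order_def dest: corner_at_position)
    then show ?thesis
      using ord xy by simp
  qed
  show bij: "bij_betw wt_bar ?A (Vert_plus N M)"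
    unfolding Vert by (rule inj_on_imp_bij_betw) (auto simp: inj_on_def dest: A wt_bar_inj)
  show "\<forall>v\<in>Vert_plus N M. nonzero_coords N v \<noteq> {}"
    unfolding Vert by (auto simp: nonzero_coords_wt_bar dest!: A)
  have "inj_on (\<lambda>v. Min (nonzero_coords N v)) (Vert_plus N M)"
  proof (rule inj_onI)
    fix v w assume "v \<in> Vert_plus N M" "w \<in> Vert_plus N M"
      "Min (nonzero_coords N v) = Min (nonzero_coords N w)"
    then obtain x y where xy: "x \<in> ?A" "y \<in> ?A" "v = wt_bar x" "w = wt_bar y" "snd x = snd y"
      unfolding Vert using Min_le by (metis (no_types, lifting) antisym imageE order_refl)
    then have "x = y"
      using ord antichain by (cases x; cases y) fastforce
    then show "v = w"
      using xy by simp
  qed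
  then show "linear_order_on (Vert_plus N M) (order_by_first N M)"
    unfolding order_by_first_def by (rule linear_order_on_inj)
  show "order_by_first N M = order_from_pivots N M"
    unfolding order_by_first_def order_from_pivots_def Vert using Min_le pivot_le by blast
  show "order_by_first N M = order_by_last N M"
    unfolding order_by_first_def order_by_last_def Vert by (auto simp: Min_le Max_le)
qed

theorem proposition3p18:
  fixes N :: nat and M :: "'k::alg_closed_field mat"
  assumes "N \<ge> 1"
    and "M \<in> carrier_mat (N + 1) (N + 1)"
    and "M \<noteq> 0\<^sub>m (N + 1) (N + 1)"
  shows "\<exists>r. linear_order_on (Vert_plus N M) r \<and>
    (upper_triangular M \<and> \<not> strictly_upper_triangular M \<longrightarrow> Vert_plus N M = {0}) \<and>
    (\<not> (upper_triangular M \<and> \<not> strictly_upper_triangular M) \<longrightarrow>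
       bij_betw wt_bar (offdiag_pivotal_entries N M) (Vert_plus N M) \<and>
       (\<forall>v\<in>Vert_plus N M. nonzero_coords N v \<noteq> {}) \<and>
       r = order_from_pivots N M \<and>
       r = order_by_first N M \<and>
       r = order_by_last N M)"
proof -
  note strict_iff = strictly_upper_triangular_iff[OF assms(2)]
  note upper_iff = upper_triangular_iff[OF assms(2)]
  note pivots = offdiag_pivotal_entries_eq[OF assms(2)]
  show ?thesis
  proof (cases "upper_triangular M \<and> \<not> strictly_upper_triangular M")
    case True
    then have upper: "i \<le> j" if "(i, j) \<in> nonzero_entries N M" for i j
      using that by (auto simp: upper_iff)
    obtain a b where "(a, b) \<in> nonzero_entries N M" "\<not> a < b"
      using True by (auto simp: strict_iff)
    with upper[of a b] have "(a, a) \<in> nonzero_entries N M"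
      by (simp add: le_less)
    then have "Vert_plus N M = {0}"
      by (intro Vert_plus_upper_triangular upper)
    moreover have "linear_order_on {0::rvec} {(0, 0)}"
      by (auto simp: order_on_defs refl_on_def trans_def antisym_def total_on_def)
    ultimately show ?thesis
      using True by (intro exI[of _ "{(0, 0)}"]) simp
  next
    case False
    have "Vert_plus N M = wt_bar ` offdiag_pivotal_entries N M \<and>
      ((\<forall>(i, j)\<in>offdiag_pivotal_entries N M. i < j) \<or> (\<forall>(i, j)\<in>offdiag_pivotal_entries N M. j < i))"
    proof (cases "strictly_upper_triangular M")
      case True
      then have upper: "i < j" if "(i, j) \<in> nonzero_entries N M" for i j
        using that by (auto simp: strict_iff)
      have "offdiag_pivotal_entries N M = minimal_entries N M"
        using True upper unfolding pivots by (fastforce simp: minimal_entries_def)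
      moreover have "Vert_plus N M = wt_bar ` minimal_entries N M"
        by (rule Vert_plus_of_entries_above_diagonal) (rule upper)
      ultimately show ?thesis
        using upper by (auto simp: minimal_entries_def)
    next
      \<comment> \<open>Since the exceptional case is excluded, \<open>M\<close> is not upper
        triangular either, which yields an entry strictly below the diagonal.\<close>
      case lower: False
      then obtain a b where "(a, b) \<in> nonzero_entries N M" "b < a"
        using False by (auto simp: upper_iff not_le)
      then have "Vert_plus N M = wt_bar ` {(i, j) \<in> minimal_entries N M. j < i}"
        by (rule Vert_plus_of_entry_below_diagonal)
      moreover have "offdiag_pivotal_entries N M = {(i, j) \<in> minimal_entries N M. j < i}"
        using lower unfolding pivots by auto
      ultimately show ?thesis by auto
    qed
    moreover have "offdiag_pivotal_entries N M \<subseteq> minimal_entries N M"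
      unfolding pivots by auto
    ultimately show ?thesis
      using False vertex_orders_agree[of N M] by metis
  qed
qed

end
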